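(* Let $\mathbb{F}$ be a finite field, let $k\in\mathbb{N}$, and suppose that $(\mu,\mathcal A)$ and $(\nu,\mathcal B)$ are $k$-Ramsey factors, with sets of colors $X_\mu$ and $X_\nu$ respectively. Then: (a) $\#X_\mu\ge\#\mathrm{GL}(\mathbb{F}^k)=\prod_{j=0}^{k-1}((\#\mathbb{F})^k-(\#\mathbb{F})^j)$; (b) if $\mathcal A\subseteq\mathcal B$, then there is a surjection $\theta:X_\mu\to X_\nu$ such that $\theta\circ\mu=\nu$; (c) if $\mathcal A=\mathcal B$, then there is a bijection $\theta:X_\mu\to X_\nu$ such that $\theta\circ\mu=\nu$.
   Context: For $n,m\in\mathbb{N}\cup\{\infty\}$, $M_{n,m}(\mathbb{F})$ is the set of $n\times m$ matrices over $\mathbb{F}$ with finitely many nonzero entries, and $M_{n,m}^k(\mathbb{F})$ the subset of those of rank $k$; finite matrices are identified with infinite ones by adding zeros, so $M_{n,k}^k(\mathbb{F})\subseteq M_{\infty,k}^k(\mathbb{F})$. Given a finite set $X$, a map $\mu:M_{\infty,k}^k(\mathbb{F})\to X$ and $\mathcal A\subseteq\bigcup_{n,m}M_{n,m}(\mathbb{F})$ ($n,m$ finite), the pair $(\mu,\mathcal A)$ is a $k$-Ramsey factor if: (i) $\mu(M_{\infty,k}^k(\mathbb{F}))=X$; (ii) $\mu(R\cdot A)=\mu(A)$ for every $A\in M_{m,k}^k(\mathbb{F})$ and every $R\in\mathcal A\cap M_{n,m}^m(\mathbb{F})$; (iii) for every $m,r\in\mathbb{N}$ there is $n\in\mathbb{N}$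 such that for every $c:M_{n,k}^k(\mathbb{F})\to\{0,\dots,r-1\}$ there are $R\in\mathcal A\cap M_{n,m}^m(\mathbb{F})$ and $\widetilde c:X\to\{0,\dots,r-1\}$ such that $c(R\cdot A)=\widetilde c(\mu(R\cdot A))$ for every $A\in M_{m,k}^k(\mathbb{F})$. $X=X_\mu$ is called the set of colors of $\mu$. *)

theory Defs
  imports
    "HOL-Library.Function_Algebras"
    "HOL-Library.Extended_Nat"
    "HOL-Library.FuncSet"
    "HOL-Library.Cardinality"
    "Jordan_Normal_Form.Matrix"
begin

(* A matrix is a function on nat * nat. An n x m matrix vanishes outside the rectangle
   {0..<n} x {0..<m}, so that the identification of finite matrices with infinite ones by adding
   zeros is an inclusion. *)
type_synonym 'a imat = "nat \<Rightarrow> nat \<Rightarrow> 'a"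

definition mats :: "enat \<Rightarrow> enat \<Rightarrow> 'a::field imat set" where
  "mats n m = {A. finite {(i, j). A i j \<noteq> 0} \<and>
                  (\<forall>i j. A i j \<noteq> 0 \<longrightarrow> enat i < n \<and> enat j < m)}"

definition seq_scale :: "'a::field \<Rightarrow> (nat \<Rightarrow> 'a) \<Rightarrow> (nat \<Rightarrow> 'a)" where
  "seq_scale a v = (\<lambda>i. a * v i)"

lemma vector_space_seq_scale: "vector_space seq_scale"
  by unfold_locales (auto simp: seq_scale_def fun_eq_iff algebra_simps)

definition column :: "'a imat \<Rightarrow> nat \<Rightarrow> (nat \<Rightarrow> 'a)" where
  "column A j = (\<lambda>i. A i j)"

(* The dimension of the column space; the columns added by zero padding do not contribute. *)
definition mat_rank :: "'a::field imat \<Rightarrow> nat" where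
  "mat_rank A = vector_space.dim seq_scale (range (column A))"

definition mats_rank :: "enat \<Rightarrow> enat \<Rightarrow> nat \<Rightarrow> 'a::field imat set" where
  "mats_rank n m k = {A \<in> mats n m. mat_rank A = k}"

(* The sum has finitely many nonzero terms whenever R is in some mats n m. *)
definition mat_prod :: "'a::field imat \<Rightarrow> 'a imat \<Rightarrow> 'a imat" (infixl "\<odot>" 70) where
  "R \<odot> A = (\<lambda>i j. \<Sum>l | R i l \<noteq> 0. R i l * A l j)"

(* In the last clause m = 0 is left out: it would only say that the zero matrix belongs to the
   family, and leaving it out covers both conventions on whether 0 is a natural number. *)
definition ramsey_factor ::
  "nat \<Rightarrow> 'x set \<Rightarrow> ('a::field imat \<Rightarrow> 'x) \<Rightarrow> 'a imat set \<Rightarrow> bool" where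
  "ramsey_factor k X \<mu> \<A> \<longleftrightarrow>
     finite X \<and>
     \<A> \<subseteq> (\<Union>n m :: nat. mats n m) \<and>
     \<mu> ` mats_rank \<infinity> k k = X \<and>
     (\<forall>n m :: nat. \<forall>A \<in> mats_rank m k k. \<forall>R \<in> \<A> \<inter> mats_rank n m m. \<mu> (R \<odot> A) = \<mu> A) \<and>
     (\<forall>m r :: nat. m > 0 \<longrightarrow>
        (\<exists>n :: nat. \<forall>c \<in> mats_rank n k k \<rightarrow> {..<r}.
           \<exists>R \<in> \<A> \<inter> mats_rank n m m. \<exists>c' \<in> X \<rightarrow> {..<r}.
             \<forall>A \<in> mats_rank m k k. c (R \<odot> A) = c' (\<mu> (R \<odot> A))))"

definition general_linear :: "nat \<Rightarrow> 'a::field mat set" where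
  "general_linear k = {A \<in> carrier_mat k k. invertible_mat A}"

end

theory Submission
  imports Defs "Jordan_Normal_Form.Determinant"
begin

text \<open>
  \<^bold>\<open>Lower bound.\<close> The number of ordered bases of a $k$-dimensional space over a field with $q$
  elements is $\prod_{j<k}(q^k-q^j)$, whatever the space. Hence all full rank matrices with $k$
  columns can be colored with that many colors in such a way that two different matrices with
  the same column space always get different colors. If $R$ is the matrix that the Ramsey
  property provides for this coloring and for $m=k$, then all products $R\cdot A$ with $A$
  invertible have the column space of $R$, and they are pairwise different because $R$ is
  injective. So they have pairwise different colors. Since the color of $R\cdot A$ is a function
  of $\mu(R\cdot A)=\mu(A)$, the map $\mu$ is injective on the invertible $k\times k$ matrices. The
  number of these is again the number of ordered bases of a $k$-dimensional space
  (\<open>card_colors_ge\<close>, \<open>card_general_linear\<close>).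

  \<^bold>\<open>Comparison of two factors.\<close> Let $\mathcal A\subseteq\mathcal B$. The map $\nu$ is itself a
  coloring by finitely many colors. Apply the Ramsey property of $(\mu,\mathcal A)$ to it and
  take the resulting $R\in\mathcal A\subseteq\mathcal B$. Both maps are invariant under
  multiplication by $R$, so that $\nu(A)=\nu(R\cdot A)$ is a function of $\mu(R\cdot A)=\mu(A)$ on
  matrices of any given finite size. Every two matrices in the domain of $\mu$ have a common
  finite size, so $\mu(A)=\mu(B)$ implies $\nu(A)=\nu(B)$ (\<open>ramsey_factor_determines\<close>). This gives
  $\theta$, and by symmetry $\theta$ is injective when $\mathcal A=\mathcal B$.
\<close>

section \<open>Linear combinations of columns\<close>

interpretation seq: vector_space seq_scale
  by (rule vector_space_seq_scale)

definition lincomb :: "nat \<Rightarrow> 'a::field imat \<Rightarrow> (nat \<Rightarrow> 'a) \<Rightarrow> nat \<Rightarrow> 'a" where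
  "lincomb d A u = (\<lambda>i. \<Sum>j<d. u j * A i j)"

definition col_space :: "nat \<Rightarrow> 'a::field imat \<Rightarrow> (nat \<Rightarrow> 'a) set" where
  "col_space d A = range (lincomb d A)"

definition indep_cols :: "nat \<Rightarrow> 'a::field imat \<Rightarrow> bool" where
  "indep_cols d A \<longleftrightarrow> (\<forall>u. lincomb d A u = 0 \<longrightarrow> (\<forall>j<d. u j = 0))"

text \<open>
  Ordered tuples of $d$ linearly independent vectors of $W$, stored as the columns of a matrix
  that is padded with zero columns. The padding makes the tuple unique as a function, so that
  frames can be counted. If $W$ has dimension $d$, they are the ordered bases of $W$.
\<close>
definition frames :: "nat \<Rightarrow> (nat \<Rightarrow> 'a::field) set \<Rightarrow> 'a imat set" where
  "frames d W = {A. (\<forall>i j. j \<ge> d \<longrightarrow> A i j = 0) \<and> (\<forall>j<d. column A j \<in> W) \<and> indep_cols d A}"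

lemma lincomb_cong: "(\<And>j. j < d \<Longrightarrow> u j = v j) \<Longrightarrow> lincomb d A u = lincomb d A v"
  by (simp add: lincomb_def)

lemma lincomb_diff: "lincomb d A (\<lambda>j. u j - v j) = lincomb d A u - lincomb d A v"
  by (simp add: lincomb_def fun_eq_iff left_diff_distrib sum_subtractf)

lemma lincomb_scale: "lincomb d A (\<lambda>j. a * u j) = seq_scale a (lincomb d A u)"
  by (simp add: lincomb_def seq_scale_def sum_distrib_left mult.assoc)

lemma lincomb_unit:
  assumes "j < d"
  shows "lincomb d A (\<lambda>l. if l = j then 1 else 0) = column A j"
proof
  fix i
  have "(\<Sum>l<d. (if l = j then 1 else 0) * A i l) = (\<Sum>l<d. if l = j then A i l else 0)"
    by (rule sum.cong) auto
  then show "lincomb d A (\<lambda>l. if l = j then 1 else 0) i = column A j i"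
    using assms by (simp add: lincomb_def column_def)
qed

lemma lincomb_Suc: "lincomb (Suc d) A u = lincomb d A u + seq_scale (u d) (column A d)"
  by (simp add: lincomb_def seq_scale_def column_def fun_eq_iff)

lemma lincomb_in_subspace:
  assumes "seq.subspace W" and "\<And>j. j < d \<Longrightarrow> column A j \<in> W"
  shows "lincomb d A u \<in> W"
  using assms(2)
proof (induction d)
  case 0
  then show ?case
    using seq.subspace_0[OF assms(1)] by (simp add: lincomb_def zero_fun_def)
next
  case (Suc d)
  then show ?case
    unfolding lincomb_Suc
    by (intro seq.subspace_add[OF assms(1)] seq.subspace_scale[OF assms(1)]) auto
qed

lemma indep_colsD: "indep_cols d A \<Longrightarrow> lincomb d A u = 0 \<Longrightarrow> j < d \<Longrightarrow> u j = 0"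
  by (simp add: indep_cols_def)

lemma lincomb_eq_iff:
  assumes "indep_cols d A"
  shows "lincomb d A u = lincomb d A v \<longleftrightarrow> (\<forall>j<d. u j = v j)"
proof
  assume "lincomb d A u = lincomb d A v"
  then have "lincomb d A (\<lambda>j. u j - v j) = 0"
    by (simp add: lincomb_diff)
  then show "\<forall>j<d. u j = v j"
    using indep_colsD[OF assms, of "\<lambda>j. u j - v j"] by auto
qed (auto intro: lincomb_cong)

text \<open>
  Distinct coefficient vectors give distinct combinations of independent columns. Coefficients
  with index at least $d$ have no influence, so that functions on \<open>{..<d}\<close> represent all
  coefficient vectors without repetition.
\<close>
lemma card_col_space:
  fixes A :: "'a::{field, finite} imat"
  assumes "indep_cols d A"
  shows "card (col_space d A) = CARD('a) ^ d"
proof -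
  let ?U = "{..<d} \<rightarrow>\<^sub>E (UNIV :: 'a set)"
  have "lincomb d A u = lincomb d A (restrict u {..<d})" for u
    by (rule lincomb_cong) simp
  moreover have "restrict u {..<d} \<in> ?U" for u
    by simp
  ultimately have "lincomb d A u \<in> lincomb d A ` ?U" for u
    by (metis imageI)
  then have "col_space d A = lincomb d A ` ?U"
    unfolding col_space_def by auto
  moreover have "inj_on (lincomb d A) ?U"
  proof (rule inj_onI)
    fix u v assume uv: "u \<in> ?U" "v \<in> ?U" "lincomb d A u = lincomb d A v"
    then have "\<forall>j<d. u j = v j"
      by (simp add: lincomb_eq_iff[OF assms])
    then show "u = v"
      using uv(1,2) by (intro PiE_ext[of u "{..<d}" "\<lambda>_. UNIV"]) auto
  qed
  ultimately show ?thesis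
    by (simp add: card_image card_PiE)
qed

lemma finite_col_space:
  fixes A :: "'a::{field, finite} imat"
  assumes "indep_cols d A"
  shows "finite (col_space d A)"
  using card_col_space[OF assms] by (intro card_ge_0_finite) simp

text \<open>
  The recursion behind the count of frames: an independent tuple is extended by exactly the
  vectors outside its span.
\<close>
lemma indep_cols_Suc:
  "indep_cols (Suc d) A \<longleftrightarrow> indep_cols d A \<and> column A d \<notin> col_space d A"
proof (intro iffI conjI)
  assume ind: "indep_cols (Suc d) A"
  have upd: "lincomb (Suc d) A (u(d := a)) = lincomb d A u + seq_scale a (column A d)" for u a
    using lincomb_cong[of d "u(d := a)" u A] by (simp add: lincomb_Suc)
  show "indep_cols d A"
    unfolding indep_cols_def
  proof (intro allI impI)
    fix u j assume "lincomb d A u = 0" "j < d"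
    then have "lincomb (Suc d) A (u(d := 0)) = 0"
      unfolding upd by simp
    then have "(u(d := 0)) j = 0"
      by (rule indep_colsD[OF ind]) (use \<open>j < d\<close> in simp)
    then show "u j = 0"
      using \<open>j < d\<close> by simp
  qed
  show "column A d \<notin> col_space d A"
  proof
    assume "column A d \<in> col_space d A"
    then obtain u where "column A d = lincomb d A u"
      by (auto simp: col_space_def)
    then have "lincomb (Suc d) A (u(d := - 1)) = 0"
      unfolding upd by simp
    then have "(u(d := - 1)) d = 0"
      by (rule indep_colsD[OF ind]) simp
    then show False
      by simp
  qed
next
  assume ind: "indep_cols d A \<and> column A d \<notin> col_space d A"
  show "indep_cols (Suc d) A"
    unfolding indep_cols_def
  proof (intro allI impI)
    fix u j assume u: "lincomb (Suc d) A u = 0" and j: "j < Suc d"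
    have ud: "u d = 0"
    proof (rule ccontr)
      assume nz: "u d \<noteq> 0"
      have "lincomb d A u = - seq_scale (u d) (column A d)"
        using u unfolding lincomb_Suc by (simp add: eq_neg_iff_add_eq_0)
      then have "lincomb d A (\<lambda>j. - inverse (u d) * u j) = column A d"
        unfolding lincomb_scale using nz by (simp add: seq_scale_def fun_eq_iff)
      then show False
        using ind unfolding col_space_def by (metis rangeI)
    qed
    then have "lincomb d A u = 0"
      using u unfolding lincomb_Suc by simp
    then show "u j = 0"
      using ud indep_colsD[of d A u j] ind j by (cases "j = d") auto
  qed
qed

lemma indep_cols_cong:
  assumes "\<And>i j. j < d \<Longrightarrow> A i j = B i j"
  shows "indep_cols d A = indep_cols d B" "col_space d A = col_space d B"
proof -
  have "lincomb d A = lincomb d B"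
    using assms by (simp add: lincomb_def fun_eq_iff)
  then show "indep_cols d A = indep_cols d B" "col_space d A = col_space d B"
    by (simp_all add: indep_cols_def col_space_def)
qed

section \<open>Counting frames\<close>

text \<open>
  A frame of length $d+1$ is a frame of length $d$ followed by a vector of $W$ outside the $q^d$
  vectors of its span. When $W$ is too small the factor is the truncated difference $0$, in
  agreement with the absence of frames.
\<close>
lemma finite_card_frames:
  fixes W :: "(nat \<Rightarrow> 'a::{field, finite}) set"
  assumes W: "seq.subspace W" "finite W"
  shows "finite (frames d W) \<and> card (frames d W) = (\<Prod>j<d. card W - CARD('a) ^ j)"
proof (induction d)
  case 0
  have "frames 0 W = {\<lambda>i j. 0}"
    by (auto simp: frames_def indep_cols_def fun_eq_iff)
  then show ?case
    by simp
next
  case (Suc d)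
  let ?S = "SIGMA B:frames d W. W - col_space d B"
  \<comment> \<open>appending a last column and splitting it off are inverse to each other\<close>
  let ?ext = "\<lambda>(B, w) i j. if j = d then w i else (B i j :: 'a)"
  let ?cut = "\<lambda>A. (\<lambda>i j. if j < d then A i j else (0 :: 'a), column A d)"
  have cut: "?cut A \<in> ?S" if A: "A \<in> frames (Suc d) W" for A
  proof -
    have "column (fst (?cut A)) j = column A j" if "j < d" for j
      using that by (simp add: column_def)
    then show ?thesis
      using A indep_cols_cong[of d "fst (?cut A)" A] by (auto simp: frames_def indep_cols_Suc)
  qed
  have ext: "?ext (B, w) \<in> frames (Suc d) W" if B: "B \<in> frames d W" "w \<in> W - col_space d B" for B w
  proof -
    have "column (?ext (B, w)) j = column B j" if "j < d" for j
      using that by (simp add: column_def)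
    moreover have "column (?ext (B, w)) d = w"
      by (simp add: column_def)
    ultimately show ?thesis
      using B indep_cols_cong[of d "?ext (B, w)" B]
      by (auto simp: frames_def indep_cols_Suc less_Suc_eq)
  qed
  have "bij_betw ?ext ?S (frames (Suc d) W)"
  proof (rule bij_betw_byWitness[where f' = ?cut])
    show "\<forall>p\<in>?S. ?cut (?ext p) = p"
      by (auto simp: frames_def fun_eq_iff column_def)
    show "\<forall>A\<in>frames (Suc d) W. ?ext (?cut A) = A"
      by (auto simp: frames_def fun_eq_iff column_def)
    show "?ext ` ?S \<subseteq> frames (Suc d) W"
      using ext by auto
    show "?cut ` frames (Suc d) W \<subseteq> ?S"
      using cut by blast
  qed
  moreover have "finite ?S"
    using Suc W(2) by auto
  moreover have "card ?S = card (frames d W) * (card W - CARD('a) ^ d)"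
  proof -
    have "card (W - col_space d B) = card W - CARD('a) ^ d" if "B \<in> frames d W" for B
    proof -
      from that have B: "indep_cols d B" "\<And>j. j < d \<Longrightarrow> column B j \<in> W"
        by (auto simp: frames_def)
      have "col_space d B \<subseteq> W"
        unfolding col_space_def using lincomb_in_subspace[OF W(1) B(2)] by auto
      then show ?thesis
        using card_Diff_subset[OF finite_col_space[OF B(1)]] card_col_space[OF B(1)] by simp
    qed
    then show ?thesis
      using Suc W(2) by simp
  qed
  ultimately show ?case
    using Suc bij_betw_finite bij_betw_same_card by (fastforce simp: mult.commute)
qed

lemma sum_seq_scale_apply: "(\<Sum>v\<in>S. seq_scale (f v) (g v)) i = (\<Sum>v\<in>S. f v * g v i)"
  by (induction S rule: infinite_finite_induct) (auto simp: seq_scale_def)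

section \<open>Full rank matrices\<close>

text \<open>
  The rank is the dimension of a set of columns in an infinite-dimensional space of sequences.
  Independence of the first $k$ columns as a family makes them pairwise different and a basis of
  their span. Conversely, in a dependent family some column is a combination of the other ones,
  and $k-1$ columns span the column space.
\<close>
lemma mat_rank_eq_iff:
  assumes "\<And>i j. k \<le> j \<Longrightarrow> A i j = 0"
  shows "mat_rank A = k \<longleftrightarrow> indep_cols k A"
proof
  assume ind: "indep_cols k A"
  have lin: "lincomb k A u = (\<Sum>j<k. seq_scale (u j) (column A j))" for u
    by (simp add: lincomb_def fun_eq_iff sum_seq_scale_apply column_def)
  have inj: "inj_on (column A) {..<k}"
  proof (rule inj_onI)
    fix j j' assume j: "j \<in> {..<k}" "j' \<in> {..<k}" "column A j = column A j'"
    then have "lincomb k A (\<lambda>l. if l = j then 1 else 0) = lincomb k A (\<lambda>l. if l = j' then 1 else 0)"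
      by (simp add: lincomb_unit)
    then show "j = j'"
      unfolding lincomb_eq_iff[OF ind] using j by (auto split: if_splits)
  qed
  \<comment> \<open>a relation on the set of columns becomes one on the family, as no column is repeated\<close>
  have "\<not> seq.dependent (column A ` {..<k})"
  proof
    assume "seq.dependent (column A ` {..<k})"
    then obtain u where u: "\<exists>v\<in>column A ` {..<k}. u v \<noteq> 0"
        "(\<Sum>v\<in>column A ` {..<k}. seq_scale (u v) v) = 0"
      by (auto simp: seq.dependent_finite)
    then have "lincomb k A (u \<circ> column A) = 0"
      unfolding lin by (simp add: sum.reindex[OF inj])
    from indep_colsD[OF ind this] show False
      using u(1) by auto
  qed
  moreover have "range (column A) \<subseteq> seq.span (column A ` {..<k})"
  proof safe
    fix j
    have "column A j = 0" if "\<not> j < k"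
      using assms that by (auto simp: column_def fun_eq_iff)
    then show "column A j \<in> seq.span (column A ` {..<k})"
      using seq.span_base[of "column A j" "column A ` {..<k}"] seq.span_zero by (cases "j < k") auto
  qed
  ultimately have "card (column A ` {..<k}) = seq.dim (range (column A))"
    by (intro seq.basis_card_eq_dim) auto
  then show "mat_rank A = k"
    by (simp add: mat_rank_def card_image[OF inj])
next
  assume rank: "mat_rank A = k"
  show "indep_cols k A"
  proof (rule ccontr)
    assume "\<not> indep_cols k A"
    then obtain u l where u: "lincomb k A u = 0" "l < k" "u l \<noteq> 0"
      by (auto simp: indep_cols_def)
    let ?T = "column A ` ({..<k} - {l})"
    \<comment> \<open>solve the relation for the column whose coefficient does not vanish\<close>
    have "column A l = (\<Sum>j\<in>{..<k} - {l}. seq_scale (- inverse (u l) * u j) (column A j))"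
    proof
      fix i
      have "(\<Sum>j<k. u j * A i j) = 0"
        using u(1) by (simp add: lincomb_def fun_eq_iff)
      then have "u l * A i l + (\<Sum>j\<in>{..<k} - {l}. u j * A i j) = 0"
        using u(2) by (simp add: sum.remove)
      then have "A i l = - inverse (u l) * (\<Sum>j\<in>{..<k} - {l}. u j * A i j)"
        using u(3) by (simp add: field_simps eq_neg_iff_add_eq_0)
      then show "column A l i = (\<Sum>j\<in>{..<k} - {l}. seq_scale (- inverse (u l) * u j) (column A j)) i"
        unfolding sum_seq_scale_apply by (simp add: column_def sum_distrib_left mult.assoc sum_negf)
    qed
    also have "\<dots> \<in> seq.span ?T"
      by (intro seq.span_sum seq.span_scale seq.span_base) auto
    finally have l: "column A l \<in> seq.span ?T" .
    have "range (column A) \<subseteq> seq.span ?T"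
    proof safe
      fix j
      consider "j = l" | "j < k" "j \<noteq> l" | "k \<le> j"
        by linarith
      then show "column A j \<in> seq.span ?T"
      proof cases
        case 3
        then have "column A j = 0"
          using assms by (auto simp: column_def fun_eq_iff)
        then show ?thesis
          by (simp add: seq.span_zero)
      qed (use l in \<open>auto intro: seq.span_base\<close>)
    qed
    then have "mat_rank A \<le> card ?T"
      unfolding mat_rank_def by (intro seq.dim_le_card) auto
    also have "\<dots> \<le> card ({..<k} - {l})"
      by (rule card_image_le) simp
    also have "\<dots> < k"
      using u(2) by simp
    finally show False
      using rank by simp
  qed
qed

text \<open>
  The coordinate space of dimension $n$, embedded into the sequences by zero padding.
\<close>
definition initial_seqs :: "nat \<Rightarrow> (nat \<Rightarrow> 'a::field) set" where
  "initial_seqs n = {v. \<forall>i\<ge>n. v i = 0}"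

text \<open>
  This turns the rank condition into a statement about frames, where counting is possible.
\<close>
lemma mats_rank_eq_frames: "mats_rank (enat n) (enat k) k = frames k (initial_seqs n)"
proof (rule Set.set_eqI, rule iffI)
  fix A :: "'a imat"
  assume "A \<in> mats_rank (enat n) (enat k) k"
  then have A: "\<And>i j. A i j \<noteq> 0 \<Longrightarrow> i < n \<and> j < k" "mat_rank A = k"
    by (auto simp: mats_rank_def mats_def)
  then have z: "\<And>i j. k \<le> j \<Longrightarrow> A i j = 0" "\<And>i j. n \<le> i \<Longrightarrow> A i j = 0"
    by (meson not_le)+
  then show "A \<in> frames k (initial_seqs n)"
    using A(2) by (auto simp: frames_def initial_seqs_def column_def mat_rank_eq_iff)
next
  fix A :: "'a imat"
  assume "A \<in> frames k (initial_seqs n)"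
  then have z: "\<And>i j. k \<le> j \<Longrightarrow> A i j = 0" "\<And>i j. n \<le> i \<Longrightarrow> j < k \<Longrightarrow> A i j = 0"
    and ind: "indep_cols k A"
    by (auto simp: frames_def initial_seqs_def column_def)
  have nz: "\<And>i j. A i j \<noteq> 0 \<Longrightarrow> i < n \<and> j < k"
    by (meson not_le z)
  then have "{(i, j). A i j \<noteq> 0} \<subseteq> {..<n} \<times> {..<k}"
    by auto
  then have "finite {(i, j). A i j \<noteq> 0}"
    by (rule finite_subset) simp
  then show "A \<in> mats_rank (enat n) (enat k) k"
    using nz ind z(1) by (auto simp: mats_rank_def mats_def mat_rank_eq_iff)
qed

lemma subspace_initial_seqs: "seq.subspace (initial_seqs n)"
  by (auto simp: seq.subspace_def initial_seqs_def seq_scale_def)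

text \<open>
  The coordinate space is the column space of the identity matrix, whose columns are independent.
\<close>
lemma card_initial_seqs:
  "finite (initial_seqs n :: (nat \<Rightarrow> 'a::{field, finite}) set) \<and>
   card (initial_seqs n :: (nat \<Rightarrow> 'a) set) = CARD('a) ^ n"
proof -
  let ?I = "\<lambda>i j. if i = j \<and> j < n then 1 else 0 :: 'a"
  have lin: "lincomb n ?I u i = (if i < n then u i else 0)" for u i
  proof -
    have "lincomb n ?I u i = (\<Sum>j<n. if j = i then u j else 0)"
      unfolding lincomb_def by (rule sum.cong) auto
    then show ?thesis
      by simp
  qed
  have ind: "indep_cols n ?I"
    unfolding indep_cols_def
  proof (intro allI impI)
    fix u :: "nat \<Rightarrow> 'a" and j assume "lincomb n ?I u = 0" "j < n"
    then show "u j = 0"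
      using lin[of u j] by simp
  qed
  have "col_space n ?I = initial_seqs n"
  proof (rule subset_antisym; rule subsetI)
    fix v :: "nat \<Rightarrow> 'a" assume "v \<in> initial_seqs n"
    then have "v = lincomb n ?I v"
      by (intro ext) (simp add: lin initial_seqs_def)
    then show "v \<in> col_space n ?I"
      unfolding col_space_def by (rule range_eqI[of v "lincomb n ?I" v])
  next
    fix v :: "nat \<Rightarrow> 'a" assume "v \<in> col_space n ?I"
    then obtain u where "v = lincomb n ?I u"
      unfolding col_space_def by (rule rangeE)
    then show "v \<in> initial_seqs n"
      by (simp add: initial_seqs_def lin)
  qed
  then show ?thesis
    using card_col_space[OF ind] finite_col_space[OF ind] by simp
qed

lemma card_mats_rank_square:
  "card (mats_rank (enat k) (enat k) k :: 'a::{field, finite} imat set) =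
     (\<Prod>j<k. CARD('a) ^ k - CARD('a) ^ j)"
  using finite_card_frames[OF subspace_initial_seqs, where 'a = 'a] card_initial_seqs[where 'a = 'a]
  by (simp add: mats_rank_eq_frames)

section \<open>The order of the general linear group\<close>

lemma invertible_mat_iff_det:
  fixes B :: "'a::field mat"
  assumes B: "B \<in> carrier_mat k k"
  shows "invertible_mat B \<longleftrightarrow> det B \<noteq> 0"
proof
  assume "invertible_mat B"
  then obtain C where C: "B * C = 1\<^sub>m k" "C * B = 1\<^sub>m (dim_row C)"
    using B by (auto simp: invertible_mat_def inverts_mat_def)
  have "dim_col C = k" "dim_row C = k"
    using arg_cong[OF C(1), of dim_col] arg_cong[OF C(2), of dim_col] B by simp_all
  then have "C \<in> carrier_mat k k"
    by auto
  from det_mult[OF B this] C(1) show "det B \<noteq> 0"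
    by auto
next
  assume "det B \<noteq> 0"
  from det_non_zero_imp_unit[OF B this, of "()"] show "invertible_mat B"
    using B by (auto simp: Units_def ring_mat_def invertible_mat_def inverts_mat_def)
qed

text \<open>
  Multiplying a vector by the matrix forms the combination of its columns, so independence of the
  columns says that the kernel is trivial, which for a square matrix means that the determinant
  does not vanish.
\<close>
lemma invertible_mat_iff_indep_cols:
  fixes A :: "'a::field imat"
  assumes "\<And>i j. k \<le> i \<Longrightarrow> A i j = 0"
  shows "invertible_mat (mat k k (\<lambda>(i, j). A i j)) \<longleftrightarrow> indep_cols k A"
proof -
  let ?B = "mat k k (\<lambda>(i, j). A i j)"
  have B: "?B \<in> carrier_mat k k"
    by simp
  have mv: "?B *\<^sub>v vec k u = vec k (lincomb k A u)" for u
    by (rule eq_vecI) (auto simp: lincomb_def scalar_prod_def lessThan_atLeast0 mult.commute)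
  have zero: "vec k f = 0\<^sub>v k \<longleftrightarrow> (\<forall>i<k. f i = 0)" for f :: "nat \<Rightarrow> 'a"
    by (auto simp: vec_eq_iff)
  have lin: "lincomb k A u = 0 \<longleftrightarrow> (\<forall>i<k. lincomb k A u i = 0)" for u
  proof -
    have "lincomb k A u i = 0" if "k \<le> i" for i
      using assms that by (simp add: lincomb_def)
    then show ?thesis
      unfolding fun_eq_iff zero_fun_def by (meson not_le)
  qed
  have "det ?B \<noteq> 0 \<longleftrightarrow> (\<forall>v\<in>carrier_vec k. ?B *\<^sub>v v = 0\<^sub>v k \<longrightarrow> v = 0\<^sub>v k)"
    using det_0_iff_vec_prod_zero_field[OF B] by auto
  also have "\<dots> \<longleftrightarrow> (\<forall>u. ?B *\<^sub>v vec k u = 0\<^sub>v k \<longrightarrow> vec k u = 0\<^sub>v k)"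
  proof (intro iffI allI ballI)
    fix v :: "'a vec"
    assume *: "\<forall>u. ?B *\<^sub>v vec k u = 0\<^sub>v k \<longrightarrow> vec k u = 0\<^sub>v k" and v: "v \<in> carrier_vec k"
    from v have "vec k (\<lambda>i. v $ i) = v"
      by auto
    with *[rule_format, of "\<lambda>i. v $ i"] show "?B *\<^sub>v v = 0\<^sub>v k \<longrightarrow> v = 0\<^sub>v k"
      by simp
  qed simp
  also have "\<dots> \<longleftrightarrow> indep_cols k A"
    unfolding mv zero indep_cols_def lin ..
  finally show ?thesis
    using invertible_mat_iff_det[OF B] by simp
qed

lemma card_general_linear:
  "card (general_linear k :: 'a::{field, finite} mat set) = (\<Prod>j<k. CARD('a) ^ k - CARD('a) ^ j)"
proof -
  let ?M = "mats_rank (enat k) (enat k) k :: 'a imat set"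
  let ?f = "\<lambda>A. mat k k (\<lambda>(i, j). A i j) :: 'a mat"
  let ?g = "\<lambda>B i j. if i < k \<and> j < k then B $$ (i, j) else 0 :: 'a"
  have zero: "A i j = 0" if "A \<in> ?M" "k \<le> i \<or> k \<le> j" for A i j
  proof (rule ccontr)
    assume "A i j \<noteq> 0"
    then have "i < k \<and> j < k"
      using that(1) by (simp add: mats_rank_def mats_def)
    then show False
      using that(2) by linarith
  qed
  have "bij_betw ?f ?M (general_linear k)"
  proof (rule bij_betw_byWitness[where f' = ?g])
    show "\<forall>A\<in>?M. ?g (?f A) = A"
      using zero by (auto simp: fun_eq_iff)
    show gl: "\<forall>B\<in>general_linear k. ?f (?g B) = B"
      by (auto simp: general_linear_def)
    show "?f ` ?M \<subseteq> general_linear k"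
    proof safe
      fix A assume A: "A \<in> ?M"
      then have "indep_cols k A"
        by (simp add: mats_rank_eq_frames frames_def)
      then show "?f A \<in> general_linear k"
        using invertible_mat_iff_indep_cols[of k A] zero[OF A] by (simp add: general_linear_def)
    qed
    show "?g ` general_linear k \<subseteq> ?M"
    proof safe
      fix B :: "'a mat" assume B: "B \<in> general_linear k"
      then have "invertible_mat (?f (?g B))"
        using gl by (simp add: general_linear_def)
      then have "indep_cols k (?g B)"
        using invertible_mat_iff_indep_cols[of k "?g B"] by simp
      then show "?g B \<in> ?M"
        by (simp add: mats_rank_eq_frames frames_def initial_seqs_def column_def)
    qed
  qed
  from bij_betw_same_card[OF this] show ?thesis
    by (simp add: card_mats_rank_square)
qed

section \<open>Products with full rank matrices\<close>

text \<open>
  The sum in a matrix product runs over the support of a row of $R$. Once the columns of $R$ from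
  index $m$ on vanish, it can be replaced by the sum over \<open>{..<m}\<close>, and left multiplication by $R$
  becomes the linear map \<open>lincomb m R\<close>.
\<close>
lemma column_mat_prod:
  assumes "\<forall>i l. m \<le> l \<longrightarrow> R i l = 0"
  shows "column (R \<odot> A) j = lincomb m R (column A j)"
proof
  fix i
  have "{l. R i l \<noteq> 0} \<subseteq> {..<m}"
  proof (rule subsetI, rule ccontr)
    fix l assume "l \<in> {l. R i l \<noteq> 0}" "l \<notin> {..<m}"
    then show False
      using assms by simp
  qed
  then have "(\<Sum>l | R i l \<noteq> 0. R i l * A l j) = (\<Sum>l<m. R i l * A l j)"
    by (intro sum.mono_neutral_left) auto
  then show "column (R \<odot> A) j i = lincomb m R (column A j) i"
    by (simp add: mat_prod_def lincomb_def column_def mult.commute)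
qed

lemma lincomb_lincomb:
  assumes "\<forall>i l. m \<le> l \<longrightarrow> R i l = 0"
  shows "lincomb k (R \<odot> A) u = lincomb m R (lincomb k A u)"
proof
  fix i
  have "(R \<odot> A) i j = (\<Sum>l<m. A l j * R i l)" for j
  proof -
    have "column (R \<odot> A) j i = lincomb m R (column A j) i"
      unfolding column_mat_prod[OF assms] ..
    then show ?thesis
      by (simp add: lincomb_def column_def)
  qed
  then have "lincomb k (R \<odot> A) u i = (\<Sum>j<k. \<Sum>l<m. u j * (A l j * R i l))"
    by (simp add: lincomb_def sum_distrib_left)
  also have "\<dots> = (\<Sum>l<m. \<Sum>j<k. u j * (A l j * R i l))"
    by (rule sum.swap)
  also have "\<dots> = lincomb m R (lincomb k A u) i"
    by (simp add: lincomb_def sum_distrib_right mult.assoc)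
  finally show "lincomb k (R \<odot> A) u i = lincomb m R (lincomb k A u) i" .
qed

text \<open>
  Left multiplication by a full rank matrix is an injective linear map, hence it maps frames to
  frames.
\<close>
lemma mat_prod_frames:
  assumes R: "R \<in> frames m W" and W: "seq.subspace W" and A: "A \<in> frames k (initial_seqs m)"
  shows "R \<odot> A \<in> frames k W" and "col_space k (R \<odot> A) \<subseteq> col_space m R"
proof -
  have R0: "\<forall>i l. m \<le> l \<longrightarrow> R i l = 0" and indR: "indep_cols m R"
    using R unfolding frames_def by simp_all
  note lin = lincomb_lincomb[OF R0]
  have "indep_cols k (R \<odot> A)"
    unfolding indep_cols_def
  proof (intro allI impI)
    fix u j assume u: "lincomb k (R \<odot> A) u = 0" "j < k"
    then have "\<forall>i<m. lincomb k A u i = 0"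
      using indep_colsD[OF indR, of "lincomb k A u"] by (simp add: lin)
    moreover have "lincomb k A u \<in> initial_seqs m"
      by (rule lincomb_in_subspace[OF subspace_initial_seqs]) (use A in \<open>simp add: frames_def\<close>)
    ultimately have "lincomb k A u i = 0" for i
      by (cases "i < m") (simp_all add: initial_seqs_def)
    then have "lincomb k A u = 0"
      by (simp add: fun_eq_iff)
    then show "u j = 0"
      using A u(2) indep_colsD[of k A u j] by (simp add: frames_def)
  qed
  moreover have "column (R \<odot> A) j \<in> W" for j
    unfolding column_mat_prod[OF R0]
    by (rule lincomb_in_subspace[OF W]) (use R in \<open>simp add: frames_def\<close>)
  moreover have "(R \<odot> A) i j = 0" if "k \<le> j" for i j
  proof -
    have "A l j = 0" for l
      using A that unfolding frames_def by simp
    then show ?thesis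
      by (simp add: mat_prod_def)
  qed
  ultimately show "R \<odot> A \<in> frames k W"
    unfolding frames_def by simp
  show "col_space k (R \<odot> A) \<subseteq> col_space m R"
    unfolding col_space_def by (rule image_subsetI) (simp add: lin)
qed

lemma mat_prod_left_cancel:
  fixes A B R :: "'a::field imat"
  assumes R: "R \<in> frames m W" and A: "A \<in> frames k (initial_seqs m)"
    and B: "B \<in> frames k (initial_seqs m)" and eq: "R \<odot> A = R \<odot> B"
  shows "A = B"
proof (intro ext)
  fix i j
  have R0: "\<forall>i l. m \<le> l \<longrightarrow> R i l = 0" and indR: "indep_cols m R"
    using R unfolding frames_def by simp_all
  have "lincomb m R (column A j) = lincomb m R (column B j)"
    unfolding column_mat_prod[OF R0, symmetric] eq ..
  then have "A i j = B i j" if "i < m"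
    using that unfolding lincomb_eq_iff[OF indR] by (simp add: column_def)
  moreover have zero: "C i j = 0" if "C \<in> frames k (initial_seqs m)" "m \<le> i" for C :: "'a imat"
    using that by (cases "j < k") (simp_all add: frames_def initial_seqs_def column_def)
  ultimately show "A i j = B i j"
    using zero[OF A] zero[OF B] by (cases "i < m") simp_all
qed

section \<open>The lower bound for the number of colors\<close>

lemma subspace_col_space: "seq.subspace (col_space d A)"
proof (rule seq.subspaceI)
  show "0 \<in> col_space d A"
    unfolding col_space_def by (rule image_eqI[of _ _ 0]) (auto simp: lincomb_def fun_eq_iff)
  show "v + w \<in> col_space d A" if "v \<in> col_space d A" "w \<in> col_space d A" for v w
  proof -
    from that obtain a b where "v = lincomb d A a" "w = lincomb d A b"
      by (auto simp: col_space_def)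
    then have "v + w = lincomb d A (\<lambda>j. a j + b j)"
      by (simp add: lincomb_def fun_eq_iff distrib_right sum.distrib)
    then show ?thesis
      by (simp add: col_space_def)
  qed
  show "seq_scale a v \<in> col_space d A" if "v \<in> col_space d A" for a v
    using that unfolding col_space_def by (auto simp flip: lincomb_scale)
qed

lemma column_in_col_space: "j < d \<Longrightarrow> column A j \<in> col_space d A"
  unfolding col_space_def by (metis lincomb_unit rangeI)

text \<open>
  The matrices with a given column space are frames of that space, and their number is the same
  for every column space and does not depend on the number $n$ of rows. Numbering them separately
  for each column space gives the coloring. The independence of $n$ matters, because in the
  Ramsey property the number of colors is given before $n$.
\<close>
lemma exists_coloring_inj_on_col_space:
  fixes k n :: nat
  obtains c :: "'a::{field, finite} imat \<Rightarrow> nat"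
  where "c \<in> frames k (initial_seqs n) \<rightarrow> {..<\<Prod>j<k. CARD('a) ^ k - CARD('a) ^ j}"
    and "\<And>A B. A \<in> frames k (initial_seqs n) \<Longrightarrow> B \<in> frames k (initial_seqs n) \<Longrightarrow>
           col_space k A = col_space k B \<Longrightarrow> c A = c B \<Longrightarrow> A = B"
proof -
  let ?F = "frames k (initial_seqs n) :: 'a imat set"
  let ?r = "\<Prod>j<k. CARD('a) ^ k - CARD('a) ^ j"
  have ex: "\<exists>f. bij_betw f (frames k (col_space k A)) {..<?r}" if "A \<in> ?F" for A
  proof -
    from that have ind: "indep_cols k A"
      by (simp add: frames_def)
    have "finite (frames k (col_space k A)) \<and> card (frames k (col_space k A)) = ?r"
      using finite_card_frames[OF subspace_col_space finite_col_space[OF ind]]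
      by (simp add: card_col_space[OF ind])
    then show ?thesis
      by (metis ex_bij_betw_finite_nat lessThan_atLeast0)
  qed
  \<comment> \<open>one numbering per space, so that matrices with equal column space use the same one\<close>
  define f where "f W = (SOME f. bij_betw f (frames k W) {..<?r})" for W :: "(nat \<Rightarrow> 'a) set"
  have f: "bij_betw (f (col_space k A)) (frames k (col_space k A)) {..<?r}" if "A \<in> ?F" for A
    unfolding f_def using someI_ex[OF ex[OF that]] .
  have mem: "A \<in> frames k (col_space k A)" if "A \<in> ?F" for A
    using that by (auto simp: frames_def column_in_col_space)
  show thesis
  proof (rule that[of "\<lambda>A. f (col_space k A) A"])
    show "(\<lambda>A. f (col_space k A) A) \<in> ?F \<rightarrow> {..<?r}"
      using f mem by (blast dest: bij_betwE)
    show "A = B" if "A \<in> ?F" "B \<in> ?F" "col_space k A = col_space k B"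
      "f (col_space k A) A = f (col_space k B) B" for A B
      using f[OF that(1)] mem[OF that(1)] mem[OF that(2)] that(3,4)
      by (metis bij_betw_imp_inj_on inj_onD)
  qed
qed

text \<open>
  The Ramsey property, applied to the coloring above, makes $\mu$ injective on the full rank square
  matrices. The case $k=0$ is separate because the Ramsey property concerns positive sizes
  only; there the bound says that there is at least one color.
\<close>
lemma card_colors_ge:
  fixes \<mu> :: "'a::{field, finite} imat \<Rightarrow> 'x"
  assumes rf: "ramsey_factor k X \<mu> \<A>"
  shows "(\<Prod>j<k. CARD('a) ^ k - CARD('a) ^ j) \<le> card X"
proof (cases "k = 0")
  case True
  have "(\<lambda>i j. 0) \<in> (mats_rank (enat 0) (enat 0) 0 :: 'a imat set)"
    by (simp add: mats_rank_eq_frames frames_def indep_cols_def)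
  then have "(\<lambda>i j. 0) \<in> (mats_rank \<infinity> (enat k) k :: 'a imat set)"
    using True by (auto simp: mats_rank_def mats_def)
  then have "card X > 0"
    using rf unfolding ramsey_factor_def card_gt_0_iff by blast
  then show ?thesis
    using True by simp
next
  case False
  let ?r = "\<Prod>j<k. CARD('a) ^ k - CARD('a) ^ j"
  let ?G = "mats_rank (enat k) (enat k) k :: 'a imat set"
  from rf False obtain n where n: "\<forall>c \<in> mats_rank (enat n) (enat k) k \<rightarrow> {..<?r}.
      \<exists>R \<in> \<A> \<inter> mats_rank (enat n) (enat k) k. \<exists>c' \<in> X \<rightarrow> {..<?r}.
        \<forall>A \<in> ?G. c (R \<odot> A) = c' (\<mu> (R \<odot> A))"
    unfolding ramsey_factor_def by blast
  obtain c :: "'a imat \<Rightarrow> nat" where c: "c \<in> frames k (initial_seqs n) \<rightarrow> {..<?r}"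
    and c_inj: "\<And>A B. A \<in> frames k (initial_seqs n) \<Longrightarrow> B \<in> frames k (initial_seqs n) \<Longrightarrow>
           col_space k A = col_space k B \<Longrightarrow> c A = c B \<Longrightarrow> A = B"
    using exists_coloring_inj_on_col_space[of k n] by blast
  from n c obtain R c' where R: "R \<in> \<A>" "R \<in> mats_rank (enat n) (enat k) k"
    and c': "\<And>A. A \<in> ?G \<Longrightarrow> c (R \<odot> A) = c' (\<mu> (R \<odot> A))"
    unfolding mats_rank_eq_frames by blast
  have RF: "R \<in> frames k (initial_seqs n)"
    using R(2) by (simp add: mats_rank_eq_frames)
  have \<mu>R: "\<mu> (R \<odot> A) = \<mu> A" if "A \<in> ?G" for A
    using rf R that unfolding ramsey_factor_def by blast
  have prod: "R \<odot> A \<in> frames k (initial_seqs n)" "col_space k (R \<odot> A) = col_space k R" 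
    if "A \<in> ?G" for A
  proof -
    note A = that[unfolded mats_rank_eq_frames]
    show F: "R \<odot> A \<in> frames k (initial_seqs n)"
      by (rule mat_prod_frames(1)[OF RF subspace_initial_seqs A])
    from F RF have ind: "indep_cols k (R \<odot> A)" "indep_cols k R"
      by (simp_all add: frames_def)
    \<comment> \<open>one space contains the other, and both have \<open>CARD('a) ^ k\<close> elements\<close>
    show "col_space k (R \<odot> A) = col_space k R"
      using mat_prod_frames(2)[OF RF subspace_initial_seqs A] ind
      by (intro card_subset_eq) (simp_all add: finite_col_space card_col_space)
  qed
  have "inj_on \<mu> ?G"
  proof (rule inj_onI)
    fix A B assume AB: "A \<in> ?G" "B \<in> ?G" "\<mu> A = \<mu> B"
    then have "c (R \<odot> A) = c (R \<odot> B)"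
      by (simp add: c' \<mu>R)
    then have "R \<odot> A = R \<odot> B"
      using c_inj prod AB by simp
    then show "A = B"
      using mat_prod_left_cancel[OF RF] AB unfolding mats_rank_eq_frames by blast
  qed
  moreover have "\<mu> ` ?G \<subseteq> X"
  proof -
    have "?G \<subseteq> mats_rank \<infinity> (enat k) k"
      by (auto simp: mats_rank_def mats_def)
    then show ?thesis
      using rf unfolding ramsey_factor_def by blast
  qed
  ultimately show ?thesis
    using rf card_inj_on_le[of \<mu> ?G X] by (simp add: card_mats_rank_square ramsey_factor_def)
qed

section \<open>Comparison of two Ramsey factors\<close>

lemma finite_support_in_mats_rank:
  assumes "A \<in> mats_rank \<infinity> (enat k) k"
  obtains p where "\<And>m. p \<le> m \<Longrightarrow> A \<in> mats_rank (enat m) (enat k) k"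
proof -
  let ?S = "{(i, j). A i j \<noteq> 0}"
  have A: "finite ?S" "\<And>i j. A i j \<noteq> 0 \<Longrightarrow> j < k" "mat_rank A = k"
    using assms by (auto simp: mats_rank_def mats_def)
  obtain p where p: "\<forall>i\<in>fst ` ?S. i < p"
    using finite_nat_set_iff_bounded[of "fst ` ?S"] A(1) by auto
  then have "A \<in> mats_rank (enat m) (enat k) k" if "p \<le> m" for m
    using that A by (force simp: mats_rank_def mats_def)
  then show ?thesis
    using that by blast
qed

text \<open>
  The second factor serves as a coloring for the first one. The matrix $R$ supplied by the Ramsey
  property lies in both families, so it changes neither of the two values.
\<close>
lemma ramsey_factor_determines:
  assumes rf: "ramsey_factor k X \<mu> \<A>" and rf': "ramsey_factor k Y \<nu> \<B>" and sub: "\<A> \<subseteq> \<B>"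
    and A: "A \<in> mats_rank \<infinity> (enat k) k" and B: "B \<in> mats_rank \<infinity> (enat k) k"
    and eq: "\<mu> A = \<mu> B"
  shows "\<nu> A = \<nu> B"
proof -
  obtain p q where p: "\<And>m. p \<le> m \<Longrightarrow> A \<in> mats_rank (enat m) (enat k) k"
    and q: "\<And>m. q \<le> m \<Longrightarrow> B \<in> mats_rank (enat m) (enat k) k"
    using finite_support_in_mats_rank[OF A] finite_support_in_mats_rank[OF B] by metis
  \<comment> \<open>a common size for \<open>A\<close> and \<open>B\<close>; the successor makes it positive, as the Ramsey property requires\<close>
  define m where "m = Suc (p + q)"
  have m: "m > 0" "A \<in> mats_rank (enat m) (enat k) k" "B \<in> mats_rank (enat m) (enat k) k"
    using p q by (simp_all add: m_def)
  have Y: "finite Y" "\<nu> ` mats_rank \<infinity> (enat k) k = Y"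
    using rf' by (simp_all add: ramsey_factor_def)
  obtain e where e: "bij_betw e Y {..<card Y}"
    using ex_bij_betw_finite_nat[OF Y(1)] by (auto simp: lessThan_atLeast0)
  from rf m(1) obtain n where n: "\<forall>c \<in> mats_rank (enat n) (enat k) k \<rightarrow> {..<card Y}.
      \<exists>R \<in> \<A> \<inter> mats_rank (enat n) (enat m) m. \<exists>c' \<in> X \<rightarrow> {..<card Y}.
        \<forall>A \<in> mats_rank (enat m) (enat k) k. c (R \<odot> A) = c' (\<mu> (R \<odot> A))"
    unfolding ramsey_factor_def by blast
  have "mats_rank (enat n) (enat k) k \<subseteq> mats_rank \<infinity> (enat k) k"
    by (auto simp: mats_rank_def mats_def)
  then have "(\<lambda>A. e (\<nu> A)) \<in> mats_rank (enat n) (enat k) k \<rightarrow> {..<card Y}"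
    using Y(2) bij_betwE[OF e] by blast
  from bspec[OF n this] obtain R c' where R: "R \<in> \<A>" "R \<in> mats_rank (enat n) (enat m) m"
    and c': "\<And>A. A \<in> mats_rank (enat m) (enat k) k \<Longrightarrow> e (\<nu> (R \<odot> A)) = c' (\<mu> (R \<odot> A))"
    by blast
  have "e (\<nu> A) = c' (\<mu> A)" if "A \<in> mats_rank (enat m) (enat k) k" for A
  proof -
    have "\<mu> (R \<odot> A) = \<mu> A"
      using rf R that unfolding ramsey_factor_def by blast
    moreover have "\<nu> (R \<odot> A) = \<nu> A"
      using rf' R sub that unfolding ramsey_factor_def by blast
    ultimately show ?thesis
      using c'[OF that] by simp
  qed
  then have "e (\<nu> A) = e (\<nu> B)"
    using m eq by simp
  moreover have "\<nu> A \<in> Y" "\<nu> B \<in> Y"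
    using A B Y(2) by blast+
  ultimately show ?thesis
    using bij_betw_imp_inj_on[OF e] by (meson inj_onD)
qed

lemma ramsey_factor_map:
  assumes rf: "ramsey_factor k X \<mu> \<A>" and rf': "ramsey_factor k Y \<nu> \<B>" and sub: "\<A> \<subseteq> \<B>"
  obtains \<theta> where "\<theta> ` X = Y" and "\<And>A. A \<in> mats_rank \<infinity> (enat k) k \<Longrightarrow> \<theta> (\<mu> A) = \<nu> A"
proof -
  let ?M = "mats_rank \<infinity> (enat k) k"
  \<comment> \<open>any preimage under \<open>\<mu>\<close> may be chosen, since the value of \<open>\<nu>\<close> is the same on all of them\<close>
  define \<theta> where "\<theta> x = \<nu> (SOME A. A \<in> ?M \<and> \<mu> A = x)" for x
  have \<theta>: "\<theta> (\<mu> A) = \<nu> A" if "A \<in> ?M" for A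
  proof -
    have "(SOME B. B \<in> ?M \<and> \<mu> B = \<mu> A) \<in> ?M \<and> \<mu> (SOME B. B \<in> ?M \<and> \<mu> B = \<mu> A) = \<mu> A"
      by (rule someI[where x = A]) (simp add: that)
    then show ?thesis
      unfolding \<theta>_def by (intro ramsey_factor_determines[OF rf rf' sub _ that]) simp_all
  qed
  have "X = \<mu> ` ?M" "Y = \<nu> ` ?M"
    using rf rf' by (simp_all add: ramsey_factor_def)
  then have "\<theta> ` X = Y"
    using \<theta> by (simp add: image_image)
  from this \<theta> show thesis
    by (rule that)
qed

theorem proposition1p14:
  fixes k :: nat
    and \<mu> :: "'a::{field, finite} imat \<Rightarrow> 'x" and \<nu> :: "'a imat \<Rightarrow> 'y"
    and X\<^sub>\<mu> :: "'x set" and X\<^sub>\<nu> :: "'y set"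
    and \<A> \<B> :: "'a imat set"
  assumes "ramsey_factor k X\<^sub>\<mu> \<mu> \<A>"
    and "ramsey_factor k X\<^sub>\<nu> \<nu> \<B>"
  shows "(card X\<^sub>\<mu> \<ge> card (general_linear k :: 'a mat set) \<and>
          card (general_linear k :: 'a mat set) = (\<Prod>j<k. CARD('a) ^ k - CARD('a) ^ j)) \<and>
         (\<A> \<subseteq> \<B> \<longrightarrow>
           (\<exists>\<theta>. \<theta> ` X\<^sub>\<mu> = X\<^sub>\<nu> \<and> (\<forall>A \<in> mats_rank \<infinity> k k. \<theta> (\<mu> A) = \<nu> A))) \<and>
         (\<A> = \<B> \<longrightarrow>
           (\<exists>\<theta>. bij_betw \<theta> X\<^sub>\<mu> X\<^sub>\<nu> \<and> (\<forall>A \<in> mats_rank \<infinity> k k. \<theta> (\<mu> A) = \<nu> A)))"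
proof (intro conjI impI)
  show "card (general_linear k :: 'a mat set) = (\<Prod>j<k. CARD('a) ^ k - CARD('a) ^ j)"
    by (rule card_general_linear)
  then show "card X\<^sub>\<mu> \<ge> card (general_linear k :: 'a mat set)"
    using card_colors_ge[OF assms(1)] by simp
  show "\<exists>\<theta>. \<theta> ` X\<^sub>\<mu> = X\<^sub>\<nu> \<and> (\<forall>A \<in> mats_rank \<infinity> k k. \<theta> (\<mu> A) = \<nu> A)" if "\<A> \<subseteq> \<B>"
    by (rule ramsey_factor_map[OF assms that]) (intro exI conjI ballI)
  show "\<exists>\<theta>. bij_betw \<theta> X\<^sub>\<mu> X\<^sub>\<nu> \<and> (\<forall>A \<in> mats_rank \<infinity> k k. \<theta> (\<mu> A) = \<nu> A)" if eq: "\<A> = \<B>"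
  proof -
    obtain \<theta> where \<theta>: "\<theta> ` X\<^sub>\<mu> = X\<^sub>\<nu>" "\<And>A. A \<in> mats_rank \<infinity> k k \<Longrightarrow> \<theta> (\<mu> A) = \<nu> A"
      by (rule ramsey_factor_map[OF assms]) (simp_all add: eq)
    have X: "X\<^sub>\<mu> = \<mu> ` mats_rank \<infinity> k k"
      using assms(1) by (simp add: ramsey_factor_def)
    have "inj_on \<theta> X\<^sub>\<mu>"
    proof (rule inj_onI)
      fix x y assume xy: "x \<in> X\<^sub>\<mu>" "y \<in> X\<^sub>\<mu>" "\<theta> x = \<theta> y"
      then obtain A B where A: "A \<in> mats_rank \<infinity> k k" "x = \<mu> A"
        and B: "B \<in> mats_rank \<infinity> k k" "y = \<mu> B"
        unfolding X by blast
      have "\<nu> A = \<nu> B"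
        using xy(3) \<theta>(2)[OF A(1)] \<theta>(2)[OF B(1)] by (simp add: A(2) B(2))
      \<comment> \<open>with the roles exchanged, \<open>\<nu>\<close> determines \<open>\<mu>\<close>\<close>
      then show "x = y"
        unfolding A(2) B(2) by (intro ramsey_factor_determines[OF assms(2,1) _ A(1) B(1)]) (simp_all add: eq)
    qed
    then show ?thesis
      using \<theta> by (auto simp: bij_betw_def)
  qed
qed

end
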